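(* Let $d\geq 2$, let $k=\lfloor d/2\rfloor$, and let $s:\mathbb{N}\to\mathbb{N}$, $n\mapsto s(n)\ge 1$, satisfy $s(n)=o(n)$. For sufficiently large $n$, write $s=s(n)$ and let $\mathcal{F}^{n,d}_s$ be the following family of $d$-subsets of $[n]=\{1,\dots,n\}$: if $d=2k$, $$\mathcal{F}^{n,d}_{s}=\{\{i_1<i_2<\dots< i_{2k}\}\subseteq[n]: \exists\, 1\leq \ell \leq s \text{ such that } i_{2j}-i_{2j-1}=\ell \ \text{for all } 1\leq j\leq k \};$$ if $d=2k+1$, $$\mathcal{F}^{n,d}_{s}=\{\{i_1<\dots<i_{2k}< i_{2k+1}\}\subseteq[n] : i_{2k+1}-i_{2k}\leq s \text{ and } \exists\, 1\leq \ell \leq s \text{ such that } i_{2j}-i_{2j-1}=\ell \ \text{for all } 1\leq j\leq k\}.$$ Let $T$ denote the minimum size of a subset of $[n]$ meeting every member of $\mathcal{F}^{n,d}_s$ (the transversal number of the pure $(d-1)$-dimensional complex with facet set $\mathcal{F}^{n,d}_s$). Then $T\geq n\left(1-\frac{1}{s+1}\right)-ks$ if $d=2k$, and $T\geq n\left(1-\frac{2}{s+2}\right)-2ks$ if $d=2k+1$. Furthermore, $\mathcal{F}^{n,d}_s$ has a transversal of size $n-\lfloor \frac{n}{s+1}\rfloor$.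
   Context: A transversal of a family of sets (or of a pure simplicial complex, with respect to its facets) is a set of vertices meeting every member (every facet). *)

theory Defs
  imports Complex_Main "HOL-Library.Landau_Symbols"
begin

definition is_transversal :: "'a set \<Rightarrow> 'a set set \<Rightarrow> 'a set \<Rightarrow> bool" where
  "is_transversal V \<F> T \<longleftrightarrow> T \<subseteq> V \<and> (\<forall>A\<in>\<F>. T \<inter> A \<noteq> {})"

(* Meaningful only if V is finite and some transversal inside V exists, i.e. every
   member of the family meets V; otherwise Min is unspecified. *)
definition transversal_number :: "'a set \<Rightarrow> 'a set set \<Rightarrow> nat" where
  "transversal_number V \<F> = Min {card T | T. is_transversal V \<F> T}"

(* A set {i_1 < ... < i_d} is the image of {1..d} under an increasing enumeration i, so
   the differences below are never truncated. The vertex set is {1..n}. *)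
definition gap_family :: "nat \<Rightarrow> nat \<Rightarrow> nat \<Rightarrow> nat set set" where
  "gap_family n d s =
     (let k = d div 2 in
      if even d then
        {i ` {1..2*k} | i. strict_mono_on {1..2*k} i \<and> i ` {1..2*k} \<subseteq> {1..n} \<and>
           (\<exists>l. 1 \<le> l \<and> l \<le> s \<and> (\<forall>j\<in>{1..k}. i (2*j) - i (2*j - 1) = l))}
      else
        {i ` {1..2*k+1} | i. strict_mono_on {1..2*k+1} i \<and> i ` {1..2*k+1} \<subseteq> {1..n} \<and>
           i (2*k+1) - i (2*k) \<le> s \<and>
           (\<exists>l. 1 \<le> l \<and> l \<le> s \<and> (\<forall>j\<in>{1..k}. i (2*j) - i (2*j - 1) = l))})"

end

theory Submission
  imports Defs
begin

text \<open>
  Let \<open>I\<close> be the complement of a transversal, with elements \<open>a\<^sub>0 < a\<^sub>1 < \<dots>\<close> and gaps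
  \<open>g\<^sub>j = a\<^sub>j\<^sub>+\<^sub>1 - a\<^sub>j\<close>. For even \<open>d\<close>, no \<open>l \<le> s\<close> occurs \<open>2k - 1\<close> times among
  the gaps, since every other occurrence would give \<open>k\<close> disjoint pairs at distance \<open>l\<close>. Hence
  the total deficit \<open>\<Sum> max 0 (s + 1 - g\<^sub>j)\<close> is at most
  \<open>(2k - 2)(1 + \<dots> + s) = (k - 1) s (s + 1)\<close>, while the gaps sum to less than \<open>n\<close>.
  For odd \<open>d\<close> the same holds for the occurrences of \<open>l\<close> followed by a gap \<open>\<le> s\<close>, so all but
  \<open>(2k - 2) s\<close> of the sums \<open>g\<^sub>j + g\<^sub>j\<^sub>+\<^sub>1\<close> are at least \<open>s + 2\<close>, while these sums
  add up to less than \<open>2n\<close>. The multiples of \<open>s + 1\<close> form the complement of a transversal.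
\<close>

section \<open>Disjoint pairs of consecutive indices and their enumeration\<close>

text \<open>Take every other element of \<open>J\<close> in increasing order: the skipped element
  forces a distance of at least 2. Thus the index pairs \<open>b t, b t + 1\<close> are disjoint,
  and \<open>2 * k - 1\<close> elements are enough for \<open>k\<close> choices.\<close>

lemma ex_spaced_selection:
  fixes J :: "nat set"
  assumes "finite J" "2 * k - 1 \<le> card J"
  shows "\<exists>b. (\<forall>t\<in>{1..k}. b t \<in> J) \<and> (\<forall>t. 1 \<le> t \<and> t < k \<longrightarrow> b t + 1 < b (Suc t))"
proof -
  let ?xs = "sorted_list_of_set J"
  have len: "length ?xs = card J" by simp
  have mono: "?xs ! p < ?xs ! q" if "p < q" "q < card J" for p q
    using that strict_sorted_list_of_set[of J] by (metis len sorted_wrt_nth_less)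
  define b where "b t = ?xs ! (2 * t - 2)" for t
  have "b t \<in> J" if "t \<in> {1..k}" for t
  proof -
    have "2 * t - 2 < length ?xs" using that assms(2) len by auto
    then have "b t \<in> set ?xs" unfolding b_def by (rule nth_mem)
    then show ?thesis using assms(1) by simp
  qed
  moreover have "b t + 1 < b (Suc t)" if "1 \<le> t" "t < k" for t
  proof -
    have "?xs ! (2 * t - 2) < ?xs ! (2 * t - 1)" using that assms(2) by (intro mono) auto
    moreover have "?xs ! (2 * t - 1) < ?xs ! (2 * t)" using that assms(2) by (intro mono) auto
    ultimately show ?thesis by (simp add: b_def)
  qed
  ultimately show ?thesis by blast
qed

text \<open>The sequence b 1, b 1 + 1, b 2, b 2 + 1, ..., starting at position 1, so that the t-th
  pair occupies positions 2t - 1 and 2t as in \<open>gap_family\<close>.\<close>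

definition interleave :: "(nat \<Rightarrow> nat) \<Rightarrow> nat \<Rightarrow> nat" where
  "interleave b q = (if odd q then b (Suc q div 2) else Suc (b (q div 2)))"

lemma interleave_odd: "1 \<le> t \<Longrightarrow> interleave b (2 * t - 1) = b t"
  by (auto simp: interleave_def)

lemma interleave_even: "interleave b (2 * t) = Suc (b t)"
  by (simp add: interleave_def)

lemma strict_mono_on_atLeastAtMost_SucI:
  fixes f :: "nat \<Rightarrow> 'a :: order"
  assumes "\<And>q. m \<le> q \<Longrightarrow> q < N \<Longrightarrow> f q < f (Suc q)"
  shows "strict_mono_on {m..N} f"
proof (rule strict_mono_onI)
  fix p q assume pq: "p \<in> {m..N}" "q \<in> {m..N}" "p < q"
  have "p < q \<Longrightarrow> q \<le> N \<Longrightarrow> f p < f q"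
  proof (induction q)
    case (Suc q)
    then show ?case using assms[of q] pq(1) by (cases "p = q") (auto intro: less_trans)
  qed simp
  then show "f p < f q" using pq by auto
qed

text \<open>Within a pair the sequence grows by 1, so only the passage from position 2t to 2t + 1
  needs a hypothesis. The bound \<open>2 * t < N\<close> means t < k for N = 2k and t \<le> k for N
  = 2k + 1.\<close>

lemma strict_mono_on_interleave:
  assumes "\<And>t. 1 \<le> t \<Longrightarrow> 2 * t < N \<Longrightarrow> b t + 1 < b (Suc t)"
  shows "strict_mono_on {1..N} (interleave b)"
proof (rule strict_mono_on_atLeastAtMost_SucI)
  fix q assume q: "1 \<le> q" "q < N"
  show "interleave b q < interleave b (Suc q)"
  proof (cases "even q")
    case True
    then obtain t where "q = 2 * t" by (elim evenE)
    then show ?thesis using q assms[of t] by (simp add: interleave_def)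
  next
    case False
    then show ?thesis by (simp add: interleave_def)
  qed
qed

lemma strict_mono_on_comp:
  assumes "strict_mono_on A f" "strict_mono_on B g" "f ` A \<subseteq> B"
  shows "strict_mono_on A (g \<circ> f)"
  by (intro strict_mono_onI) (use assms in \<open>auto simp: image_subset_iff dest: strict_mono_onD\<close>)

lemma finite_enumeration_nat:
  fixes I :: "nat set"
  assumes "finite I"
  obtains a where "strict_mono_on {..<card I} a" "a ` {..<card I} = I"
proof
  let ?a = "\<lambda>j. sorted_list_of_set I ! j"
  show "strict_mono_on {..<card I} ?a"
    by (intro strict_mono_onI) (simp add: sorted_wrt_nth_less[OF strict_sorted_list_of_set])
  show "?a ` {..<card I} = I"
    using assms nth_image[of "card I" "sorted_list_of_set I"] by (simp add: lessThan_atLeast0)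
qed

section \<open>Members of the family inside a set with many equal gaps\<close>

lemma gap_family_even:
  "gap_family n (2 * k) s =
     {i ` {1..2*k} | i. strict_mono_on {1..2*k} i \<and> i ` {1..2*k} \<subseteq> {1..n} \<and>
        (\<exists>l. 1 \<le> l \<and> l \<le> s \<and> (\<forall>j\<in>{1..k}. i (2*j) - i (2*j - 1) = l))}"
  by (simp add: gap_family_def Let_def)

lemma gap_family_odd:
  "gap_family n (2 * k + 1) s =
     {i ` {1..2*k+1} | i. strict_mono_on {1..2*k+1} i \<and> i ` {1..2*k+1} \<subseteq> {1..n} \<and>
        i (2*k+1) - i (2*k) \<le> s \<and>
        (\<exists>l. 1 \<le> l \<and> l \<le> s \<and> (\<forall>j\<in>{1..k}. i (2*j) - i (2*j - 1) = l))}"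
  by (simp add: gap_family_def Let_def)

text \<open>Each index in \<open>J\<close> marks two consecutive values of \<open>a\<close> at
  distance \<open>l\<close>. Selecting \<open>k\<close> spaced indices makes these pairs disjoint,
  and together they form a member of the family.\<close>

lemma gap_family_even_contains:
  assumes a: "strict_mono_on {..<m} a" "a ` {..<m} \<subseteq> {1..n}"
    and l: "1 \<le> l" "l \<le> s"
    and J: "finite J" "2 * k - 1 \<le> card J"
      "\<And>j. j \<in> J \<Longrightarrow> Suc j < m \<and> a (Suc j) - a j = l"
  shows "\<exists>A\<in>gap_family n (2 * k) s. A \<subseteq> a ` {..<m}"
proof -
  obtain b where b: "\<And>t. t \<in> {1..k} \<Longrightarrow> b t \<in> J"
      "\<And>t. 1 \<le> t \<Longrightarrow> t < k \<Longrightarrow> b t + 1 < b (Suc t)"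
    using ex_spaced_selection[OF J(1,2)] by blast
  have mono: "strict_mono_on {1..2*k} (interleave b)"
    by (rule strict_mono_on_interleave) (auto intro: b(2)[simplified])
  have ran: "interleave b ` {1..2*k} \<subseteq> {..<m}"
  proof clarify
    fix q assume q: "q \<in> {1..2*k}"
    have "Suc (b t) < m" "b t < m" if "t \<in> {1..k}" for t
      using J(3)[OF b(1)[OF that]] by simp_all
    moreover have "Suc q div 2 \<in> {1..k}" "even q \<Longrightarrow> q div 2 \<in> {1..k}" using q by (auto elim!: evenE)
    ultimately show "interleave b q < m" unfolding interleave_def by metis
  qed
  let ?i = "a \<circ> interleave b"
  have "strict_mono_on {1..2*k} ?i" by (rule strict_mono_on_comp[OF mono a(1) ran])
  moreover have sub: "?i ` {1..2*k} \<subseteq> a ` {..<m}" using ran by (auto simp: image_comp[symmetric])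
  moreover have "\<forall>j\<in>{1..k}. ?i (2*j) - ?i (2*j - 1) = l"
    using J(3) b(1) by (auto simp: interleave_even interleave_odd[simplified])
  ultimately have "?i ` {1..2*k} \<in> gap_family n (2 * k) s"
    unfolding gap_family_even using l a(2) by blast
  with sub show ?thesis by blast
qed

text \<open>As in the even case, with the value of \<open>a\<close> right after the last pair as the
  additional largest element; the condition on \<open>J\<close> bounds that final gap by
  \<open>s\<close>.\<close>

lemma gap_family_odd_contains:
  assumes a: "strict_mono_on {..<m} a" "a ` {..<m} \<subseteq> {1..n}"
    and l: "1 \<le> l" "l \<le> s" and k: "1 \<le> k"
    and J: "finite J" "2 * k - 1 \<le> card J"
      "\<And>j. j \<in> J \<Longrightarrow> Suc (Suc j) < m \<and> a (Suc j) - a j = l \<and> a (Suc (Suc j)) - a (Suc j) \<le> s"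
  shows "\<exists>A\<in>gap_family n (2 * k + 1) s. A \<subseteq> a ` {..<m}"
proof -
  obtain b0 where b0: "\<And>t. t \<in> {1..k} \<Longrightarrow> b0 t \<in> J"
      "\<And>t. 1 \<le> t \<Longrightarrow> t < k \<Longrightarrow> b0 t + 1 < b0 (Suc t)"
    using ex_spaced_selection[OF J(1,2)] by blast
  \<comment> \<open>The added value puts index \<open>b k + 2\<close>, the successor of the last
    pair, at position 2k + 1 of \<open>interleave b\<close>.\<close>
  define b where "b = b0(Suc k := b0 k + 2)"
  have bJ: "b t \<in> J" if "t \<in> {1..k}" for t using b0(1)[OF that] that by (auto simp: b_def)
  have bk: "b (Suc k) = b k + 2" by (simp add: b_def)
  have step: "b t + 1 < b (Suc t)" if "1 \<le> t" "t \<le> k" for t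
    using that b0(2)[of t] by (cases "t = k") (auto simp: b_def)
  have mono: "strict_mono_on {1..2*k+1} (interleave b)"
    by (rule strict_mono_on_interleave) (auto intro: step[simplified])
  have ran: "interleave b ` {1..2*k+1} \<subseteq> {..<m}"
  proof clarify
    fix q assume q: "q \<in> {1..2*k+1}"
    have "interleave b q \<le> interleave b (2 * k + 1)"
      using strict_mono_on_leD[OF mono] q by auto
    also have "\<dots> = b k + 2" using bk by (simp add: interleave_def)
    also have "\<dots> < m" using J(3)[OF bJ[of k]] k by simp
    finally show "interleave b q < m" .
  qed
  let ?i = "a \<circ> interleave b"
  have "strict_mono_on {1..2*k+1} ?i" by (rule strict_mono_on_comp[OF mono a(1) ran])
  moreover have sub: "?i ` {1..2*k+1} \<subseteq> a ` {..<m}" using ran by (auto simp: image_comp[symmetric])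
  moreover have "\<forall>j\<in>{1..k}. ?i (2*j) - ?i (2*j - 1) = l"
    using J(3) bJ by (auto simp: interleave_even interleave_odd[simplified])
  moreover have "?i (2*k+1) - ?i (2*k) \<le> s"
    using J(3)[OF bJ[of k]] k bk by (simp add: interleave_def)
  ultimately have "?i ` {1..2*k+1} \<in> gap_family n (2 * k + 1) s"
    unfolding gap_family_odd using l a(2) by blast
  with sub show ?thesis by blast
qed

section \<open>Upper bounds on sets containing no member of the family\<close>

lemma sum_gaps:
  fixes a :: "nat \<Rightarrow> nat"
  assumes "\<And>j. j < M \<Longrightarrow> a j \<le> a (Suc j)"
  shows "a 0 + (\<Sum>j<M. a (Suc j) - a j) = a M"
  using assms
proof (induction M)
  case (Suc M)
  then have "a 0 + (\<Sum>j<M. a (Suc j) - a j) = a M" "a M \<le> a (Suc M)" by auto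
  then show ?case by simp
qed simp

lemma strict_mono_on_gap_pos:
  fixes a :: "nat \<Rightarrow> nat"
  assumes "strict_mono_on {..<m} a" "Suc j < m"
  shows "1 \<le> a (Suc j) - a j"
  using strict_mono_onD[OF assms(1), of j "Suc j"] assms(2) by simp

lemma sum_gaps_le:
  fixes a :: "nat \<Rightarrow> nat"
  assumes "strict_mono_on {..<m} a" "a ` {..<m} \<subseteq> {1..n}" "M = m - 1"
  shows "(\<Sum>j<M. a (Suc j) - a j) \<le> n"
\<comment> \<open>For \<open>m = 0\<close> truncated subtraction gives \<open>M = 0\<close> and an
  empty sum; otherwise \<open>a M\<close> is the last element, and the telescoping sum is at most
  \<open>a M\<close>.\<close>
proof (cases "m = 0")
  case False
  then have "a M \<in> {1..n}" using assms(3) by (intro subsetD[OF assms(2)]) auto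
  then have "a M \<le> n" by simp
  moreover have "a j \<le> a (Suc j)" if "j < M" for j
    using strict_mono_onD[OF assms(1), of j "Suc j"] that assms(3) less_diff_conv[of j m 1] by simp
  ultimately show ?thesis using sum_gaps[of M a] by simp
qed (simp add: assms(3))

text \<open>Reversing the summation gives a triangular number. The factor 2 avoids a division and is
  later taken from 2k - 2 = 2(k - 1).\<close>

lemma sum_deficits: "2 * (\<Sum>l=1..s. Suc s - l) = s * Suc s" for s :: nat
proof -
  have "(\<Sum>l=1..s. Suc s - l) = \<Sum>{1..s}"
    using sum.atLeastAtMost_rev[of "\<lambda>l. l" 1 s] by simp
  moreover have "2 * \<Sum>{1..s} = s * Suc s" by (induction s) auto
  ultimately show ?thesis by simp
qed

lemma card_le_if_gap_family_free_even:
  assumes I: "I \<subseteq> {1..n}" and free: "\<And>A. A \<in> gap_family n (2 * k) s \<Longrightarrow> \<not> A \<subseteq> I"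
    and k: "1 \<le> k" and s: "1 \<le> s"
  shows "real (card I) \<le> real n / (real s + 1) + real k * real s"
proof -
  have "finite I" using I finite_subset by blast
  then obtain a where a: "strict_mono_on {..<card I} a" "a ` {..<card I} = I"
    by (rule finite_enumeration_nat)
  define M where "M = card I - 1"
  define g where "g j = a (Suc j) - a j" for j
  have gpos: "1 \<le> g j" if "j < M" for j
    unfolding g_def using that by (intro strict_mono_on_gap_pos[OF a(1)]) (simp add: M_def)
  have rare: "card {j\<in>{..<M}. g j = l} \<le> 2 * k - 2" if "l \<in> {1..s}" for l
  proof (rule ccontr)
    assume "\<not> ?thesis"
    then have "\<exists>A\<in>gap_family n (2 * k) s. A \<subseteq> a ` {..<card I}"
      using that a I k
      by (intro gap_family_even_contains[where J = "{j\<in>{..<M}. g j = l}" and l = l])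
        (auto simp: M_def g_def)
    then show False using free a(2) by auto
  qed
  \<comment> \<open>Truncated subtraction supplies the maximum with 0 in the deficit, so only gaps
    up to \<open>s\<close> contribute; they are then grouped by their value
    \<open>l\<close>.\<close>
  have "(\<Sum>j<M. Suc s - g j) = (\<Sum>j\<in>{j\<in>{..<M}. g j \<le> s}. Suc s - g j)"
    by (rule sum.mono_neutral_right) auto
  also have "\<dots> = (\<Sum>l=1..s. \<Sum>j\<in>{j\<in>{j\<in>{..<M}. g j \<le> s}. g j = l}. Suc s - g j)"
    using gpos by (intro sum.group[symmetric]) auto
  also have "\<dots> = (\<Sum>l=1..s. card {j\<in>{..<M}. g j = l} * (Suc s - l))"
  proof (rule sum.cong[OF refl])
    fix l assume "l \<in> {1..s}"
    then have eq: "{j\<in>{j\<in>{..<M}. g j \<le> s}. g j = l} = {j\<in>{..<M}. g j = l}" by auto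
    show "(\<Sum>j\<in>{j\<in>{j\<in>{..<M}. g j \<le> s}. g j = l}. Suc s - g j) =
        card {j\<in>{..<M}. g j = l} * (Suc s - l)"
      unfolding eq by simp
  qed
  also have "\<dots> \<le> (\<Sum>l=1..s. (2 * k - 2) * (Suc s - l))"
    using rare by (intro sum_mono mult_right_mono) auto
  also have "\<dots> = (k - 1) * (2 * (\<Sum>l=1..s. Suc s - l))"
    unfolding sum_distrib_left[symmetric] by (simp add: diff_mult_distrib)
  finally have deficit: "(\<Sum>j<M. Suc s - g j) \<le> (k - 1) * (s * Suc s)"
    unfolding sum_deficits .
  have "M * Suc s = (\<Sum>j<M. Suc s)" by simp
  also have "\<dots> \<le> (\<Sum>j<M. g j + (Suc s - g j))" by (intro sum_mono) auto
  also have "\<dots> = (\<Sum>j<M. g j) + (\<Sum>j<M. Suc s - g j)" by (rule sum.distrib)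
  also have "\<dots> \<le> n + (k - 1) * (s * Suc s)"
    using sum_gaps_le[OF a(1) _ M_def] a(2) I deficit by (intro add_mono) (auto simp: g_def)
  finally have "real (M * Suc s) \<le> real (n + (k - 1) * (s * Suc s))" by (simp only: of_nat_le_iff)
  then have "real M * (real s + 1) \<le> real n + (real k - 1) * real s * (real s + 1)"
    using k by (simp only: of_nat_mult of_nat_add of_nat_diff of_nat_Suc of_nat_1)
      (simp add: algebra_simps)
  then have "real M * (real s + 1) \<le> (real n / (real s + 1) + (real k - 1) * real s) * (real s + 1)"
    by (simp add: distrib_right[of _ _ "real s + 1"])
  then have "real M \<le> real n / (real s + 1) + (real k - 1) * real s"
    by (rule mult_right_le_imp_le) simp
  \<comment> \<open>Passing from gaps to elements costs 1, which is absorbed because (k - 1) s + 1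
    \<le> k s for s \<ge> 1.\<close>
  moreover have "real (card I) \<le> real M + 1" by (simp add: M_def)
  moreover have "1 \<le> real s" using s by simp
  ultimately show ?thesis by (simp add: algebra_simps)
qed

lemma card_le_if_gap_family_free_odd:
  assumes I: "I \<subseteq> {1..n}" and free: "\<And>A. A \<in> gap_family n (2 * k + 1) s \<Longrightarrow> \<not> A \<subseteq> I"
    and k: "1 \<le> k" and s: "1 \<le> s"
  shows "real (card I) \<le> 2 * real n / (real s + 2) + 2 * real k * real s"
proof -
  have "finite I" using I finite_subset by blast
  then obtain a where a: "strict_mono_on {..<card I} a" "a ` {..<card I} = I"
    by (rule finite_enumeration_nat)
  define M where "M = card I - 1"
  define N where "N = M - 1"
  define g where "g j = a (Suc j) - a j" for j
  have gpos: "1 \<le> g j" if "j < M" for j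
    unfolding g_def using that by (intro strict_mono_on_gap_pos[OF a(1)]) (simp add: M_def)
  \<comment> \<open>The exceptional indices. Both gaps are at least 1, so a sum of at most s + 1
    forces each of them to be at most s; hence every such index is an occurrence of some
    \<open>l\<close> in 1..s followed by a gap at most \<open>s\<close>.\<close>
  define B where "B = {j\<in>{..<N}. g j + g (Suc j) \<le> Suc s}"
  have BD: "g j \<in> {1..s}" "g (Suc j) \<le> s" if "j \<in> B" for j
  proof -
    have "Suc j < M" "g j + g (Suc j) \<le> Suc s"
      using that less_diff_conv[of j M 1] by (auto simp: B_def N_def)
    then show "g j \<in> {1..s}" "g (Suc j) \<le> s" using gpos[of j] gpos[of "Suc j"] by auto
  qed
  have rare: "card {j\<in>B. g j = l} \<le> 2 * k - 2" if "l \<in> {1..s}" for l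
  proof (rule ccontr)
    assume "\<not> ?thesis"
    then have many: "2 * k - 1 \<le> card {j\<in>B. g j = l}" by simp
    have "Suc (Suc j) < card I \<and> a (Suc j) - a j = l \<and> a (Suc (Suc j)) - a (Suc j) \<le> s"
      if "j \<in> {j\<in>B. g j = l}" for j
      using that BD(2)[of j] by (simp add: B_def g_def N_def M_def less_diff_conv)
    then have "\<exists>A\<in>gap_family n (2 * k + 1) s. A \<subseteq> a ` {..<card I}"
      using that a(2) I
      by (intro gap_family_odd_contains[OF a(1) _ _ _ k _ many]) (auto simp: B_def)
    then show False using free a(2) by auto
  qed
  have "card B = (\<Sum>j\<in>B. 1)" by simp
  also have "\<dots> = (\<Sum>l=1..s. \<Sum>j\<in>{j\<in>B. g j = l}. 1)"
    using BD(1) by (intro sum.group[symmetric]) (auto simp: B_def)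
  also have "\<dots> \<le> (\<Sum>l=1..s. 2 * k - 2)" using rare by (intro sum_mono) auto
  finally have cardB: "card B \<le> s * (2 * k - 2)" by simp
  have gsum: "(\<Sum>j<M. g j) \<le> n"
    using sum_gaps_le[OF a(1) _ M_def] a(2) I by (simp add: g_def)
  \<comment> \<open>Each gap enters at most two of the sums \<open>g j + g (Suc j)\<close>: the
    unshifted sum drops the last gap, the shifted one the first.\<close>
  have "(\<Sum>j<N. g j) \<le> (\<Sum>j<M. g j)" by (intro sum_mono2) (auto simp: N_def)
  moreover have "(\<Sum>j<N. g (Suc j)) \<le> (\<Sum>j<M. g j)"
  proof (cases M)
    case (Suc M')
    then show ?thesis by (simp add: N_def sum.lessThan_Suc_shift del: sum.lessThan_Suc)
  qed (simp add: N_def)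
  ultimately have gsum2: "(\<Sum>j<N. g j + g (Suc j)) \<le> 2 * n"
    using gsum by (simp add: sum.distrib)
  have "N * (s + 2) = (\<Sum>j<N. s + 2)" by simp
  \<comment> \<open>Outside \<open>B\<close> the two gaps already reach s + 2; an index in
    \<open>B\<close> is charged the full s + 2.\<close>
  also have "\<dots> \<le> (\<Sum>j<N. (g j + g (Suc j)) + (if j \<in> B then s + 2 else 0))"
    by (intro sum_mono) (auto simp: B_def)
  also have "\<dots> = (\<Sum>j<N. g j + g (Suc j)) + (\<Sum>j<N. if j \<in> B then s + 2 else 0)"
    by (rule sum.distrib)
  also have "(\<Sum>j<N. if j \<in> B then s + 2 else 0) = card ({..<N} \<inter> B) * (s + 2)"
    by (simp add: sum.If_cases)
  also have "{..<N} \<inter> B = B" by (auto simp: B_def)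
  also have "(\<Sum>j<N. g j + g (Suc j)) + card B * (s + 2) \<le> 2 * n + s * (2 * k - 2) * (s + 2)"
    using gsum2 cardB by (intro add_mono mult_right_mono) auto
  finally have "real (N * (s + 2)) \<le> real (2 * n + s * (2 * k - 2) * (s + 2))"
    by (simp only: of_nat_le_iff)
  moreover have "real (2 * k - 2) = 2 * real k - 2" using k by (simp add: of_nat_diff)
  ultimately have "real N * (real s + 2) \<le> 2 * real n + real s * (2 * real k - 2) * (real s + 2)"
    by (simp only: of_nat_mult of_nat_add of_nat_numeral)
  then have "real N * (real s + 2) \<le>
      (2 * real n / (real s + 2) + real s * (2 * real k - 2)) * (real s + 2)"
    by (simp add: distrib_right[of _ _ "real s + 2"])
  then have "real N \<le> 2 * real n / (real s + 2) + real s * (2 * real k - 2)"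
    by (rule mult_right_le_imp_le) simp
  \<comment> \<open>There are at most two more elements than pairs of adjacent gaps, also when the
    subtractions truncate. The extra 2 is absorbed by 2s, as s \<ge> 1.\<close>
  moreover have "real (card I) \<le> real N + 2" by (simp add: M_def N_def)
  moreover have "1 \<le> real s" using s by simp
  ultimately show ?thesis by (simp add: algebra_simps)
qed

section \<open>Transversals, their complements and the explicit construction\<close>

text \<open>The first pair i_1 < i_2 of a member serves as the witness in both parities.\<close>

lemma gap_family_member:
  assumes "A \<in> gap_family n d s" "2 \<le> d"
  obtains x y where "x \<in> A" "y \<in> A" "x < y" "y - x \<le> s" "A \<subseteq> {1..n}"
proof -
  obtain N and i :: "nat \<Rightarrow> nat" and l where i: "A = i ` {1..N}" "2 \<le> N" "strict_mono_on {1..N} i"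
      "i ` {1..N} \<subseteq> {1..n}" "l \<le> s" "\<forall>j\<in>{1..d div 2}. i (2*j) - i (2*j - 1) = l"
  proof (cases "even d")
    case True
    then have "A \<in> gap_family n (2 * (d div 2)) s" using assms by simp
    then show ?thesis unfolding gap_family_even using that[of _ "2 * (d div 2)"] assms(2) by auto
  next
    case False
    then have "A \<in> gap_family n (2 * (d div 2) + 1) s" using assms by simp
    then show ?thesis unfolding gap_family_odd using that[of _ "2 * (d div 2) + 1"] assms(2) by auto
  qed
  have "i 1 < i 2" using strict_mono_onD[OF i(3), of 1 2] i(2) by simp
  moreover have "i 2 - i 1 \<le> s" using bspec[OF i(6), of 1] i(5) assms(2) by auto
  ultimately show ?thesis using that[of "i 1" "i 2"] i(1,2,4) by auto
qed

text \<open>One transversal makes the set of sizes nonempty, and a finite \<open>V\<close> makes it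
  finite, so \<open>Min\<close> is a genuine minimum.\<close>

lemma transversal_number_attained:
  assumes "finite V" "is_transversal V \<F> T0"
  shows "\<exists>T. is_transversal V \<F> T \<and> transversal_number V \<F> = card T"
proof -
  let ?C = "{card T | T. is_transversal V \<F> T}"
  have "?C \<subseteq> card ` Pow V" by (auto simp: is_transversal_def)
  then have "finite ?C" using assms(1) finite_subset by blast
  moreover have "?C \<noteq> {}" using assms(2) by blast
  ultimately have "Min ?C \<in> ?C" by (rule Min_in)
  then show ?thesis unfolding transversal_number_def by auto
qed

lemma is_transversal_complement_iff:
  assumes "\<And>A. A \<in> \<F> \<Longrightarrow> A \<subseteq> V" "I \<subseteq> V"
  shows "is_transversal V \<F> (V - I) \<longleftrightarrow> (\<forall>A\<in>\<F>. \<not> A \<subseteq> I)"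
  using assms unfolding is_transversal_def by blast

lemma transversal_number_complement:
  assumes "2 \<le> d"
  shows "\<exists>I. I \<subseteq> {1..n} \<and> (\<forall>A\<in>gap_family n d s. \<not> A \<subseteq> I) \<and>
    real (transversal_number {1..n} (gap_family n d s)) = real n - real (card I)"
proof -
  have sub: "A \<subseteq> {1..n}" and ne: "A \<noteq> {}" if "A \<in> gap_family n d s" for A
    using gap_family_member[OF that assms] by blast+
  \<comment> \<open>The whole vertex set meets every member, since members are nonempty subsets of
    it; so the transversal number is attained.\<close>
  have "is_transversal {1..n} (gap_family n d s) {1..n}"
    using sub ne by (fastforce simp: is_transversal_def)
  then obtain T where T: "is_transversal {1..n} (gap_family n d s) T"
      "transversal_number {1..n} (gap_family n d s) = card T"
    using transversal_number_attained[of "{1..n}"] by blast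
  have Tsub: "T \<subseteq> {1..n}" using T(1) by (simp add: is_transversal_def)
  then have "card ({1..n} - T) = n - card T" "card T \<le> n"
    using card_mono[of "{1..n}" T] by (auto simp: card_Diff_subset finite_subset)
  moreover have "{1..n} - ({1..n} - T) = T" using Tsub by blast
  ultimately show ?thesis
    using is_transversal_complement_iff[OF sub Diff_subset, where B1 = T] T
    by (intro exI[of _ "{1..n} - T"]) auto
qed

lemma card_multiples_atMost:
  fixes n m :: nat
  assumes "0 < m"
  shows "card {x\<in>{1..n}. m dvd x} = n div m"
proof -
  have "{x\<in>{1..n}. m dvd x} = (\<lambda>t. m * t) ` {1..n div m}"
    using assms by (auto simp: dvd_def less_eq_div_iff_mult_less_eq mult.commute)
  then show ?thesis using assms by (simp add: card_image inj_on_def)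
qed

text \<open>Distinct multiples of s + 1 differ by more than s, whereas every member contains two
  elements at distance at most s.\<close>

lemma gap_family_transversal:
  assumes "2 \<le> d"
  shows "\<exists>S. is_transversal {1..n} (gap_family n d s) S \<and>
     int (card S) = int n - \<lfloor>real n / (real s + 1)\<rfloor>"
proof -
  define I where "I = {x\<in>{1..n}. Suc s dvd x}"
  have cardI: "card I = n div Suc s" unfolding I_def by (rule card_multiples_atMost) simp
  have "\<not> A \<subseteq> I" if A: "A \<in> gap_family n d s" for A
  proof
    assume "A \<subseteq> I"
    obtain x y where xy: "x \<in> A" "y \<in> A" "x < y" "y - x \<le> s"
      by (rule gap_family_member[OF A assms])
    then have "Suc s dvd y - x" using \<open>A \<subseteq> I\<close> by (auto simp: I_def intro: dvd_diff_nat)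
    then show False using xy by (auto dest: dvd_imp_le)
  qed
  moreover have "A \<subseteq> {1..n}" if "A \<in> gap_family n d s" for A
    using gap_family_member[OF that assms] by blast
  ultimately have "is_transversal {1..n} (gap_family n d s) ({1..n} - I)"
    by (subst is_transversal_complement_iff) (auto simp: I_def)
  moreover have "card ({1..n} - I) = n - n div Suc s"
    by (subst card_Diff_subset) (use cardI in \<open>auto simp: I_def\<close>)
  moreover have "\<lfloor>real n / (real s + 1)\<rfloor> = int (n div Suc s)"
    using floor_divide_of_nat_eq[of n "Suc s", where ?'a = real] by (simp add: add.commute)
  ultimately show ?thesis by (intro exI[of _ "{1..n} - I"]) (auto simp: of_nat_diff)
qed

theorem theorem3p6:
  fixes d k :: nat and s :: "nat \<Rightarrow> nat"
  assumes "d \<ge> 2"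
    and "k = d div 2"
    and "\<And>n. n \<ge> 1 \<Longrightarrow> s n \<ge> 1"
    and "(\<lambda>n. real (s n)) \<in> o(\<lambda>n. real n)"
  shows "\<forall>\<^sub>F n in sequentially.
     (d = 2 * k \<longrightarrow>
        real (transversal_number {1..n} (gap_family n d (s n)))
          \<ge> real n * (1 - 1 / (real (s n) + 1)) - real k * real (s n)) \<and>
     (d = 2 * k + 1 \<longrightarrow>
        real (transversal_number {1..n} (gap_family n d (s n)))
          \<ge> real n * (1 - 2 / (real (s n) + 2)) - 2 * real k * real (s n)) \<and>
     (\<exists>S. is_transversal {1..n} (gap_family n d (s n)) S \<and>
        int (card S) = int n - \<lfloor>real n / (real (s n) + 1)\<rfloor>)"
\<comment> \<open>From n = 1 on, \<open>s n\<close> is positive, as the cardinality bounds require.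
  Taking complements turns these upper bounds into lower bounds on the transversal number.\<close>
proof (rule eventually_mono[OF eventually_ge_at_top[of 1]], intro conjI impI)
  fix n :: nat assume "1 \<le> n"
  then have s: "1 \<le> s n" by (rule assms(3))
  have k: "1 \<le> k" using assms(1,2) by simp
  obtain I where I: "I \<subseteq> {1..n}" "\<And>A. A \<in> gap_family n d (s n) \<Longrightarrow> \<not> A \<subseteq> I"
      "real (transversal_number {1..n} (gap_family n d (s n))) = real n - real (card I)"
    using transversal_number_complement[OF assms(1), of n "s n"] by (elim exE conjE) simp
  show "real (transversal_number {1..n} (gap_family n d (s n)))
      \<ge> real n * (1 - 1 / (real (s n) + 1)) - real k * real (s n)" if "d = 2 * k"
    using card_le_if_gap_family_free_even[OF I(1) I(2)[unfolded that] k s] I(3)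
    by (simp add: right_diff_distrib)
  show "real (transversal_number {1..n} (gap_family n d (s n)))
      \<ge> real n * (1 - 2 / (real (s n) + 2)) - 2 * real k * real (s n)" if "d = 2 * k + 1"
    using card_le_if_gap_family_free_odd[OF I(1) I(2)[unfolded that] k s] I(3)
    by (simp add: right_diff_distrib mult.commute)
  show "\<exists>S. is_transversal {1..n} (gap_family n d (s n)) S \<and>
      int (card S) = int n - \<lfloor>real n / (real (s n) + 1)\<rfloor>"
    by (rule gap_family_transversal[OF assms(1)])
qed

end
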